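(* Let $K\subseteq S$ be an extension of commutative rings where $K$ is a field. The following properties hold: (1) $K\subseteq S$ is weakly strongly inert if and only if $K\subseteq S$ is SL. (2) If, in addition, $S$ is an integral domain, then $K\subseteq S$ is strongly inert if and only if $K\subseteq S$ is SL. In this case, $K\subseteq S$ is algebraically closed (every element of $S$ algebraic over $K$ is in $K$). (3) If $K\subseteq S$ is SL, then $K\subseteq S$ is an FCP extension if and only if either $K=S$, or $K\cong\mathbb Z/2\mathbb Z$ and $S\cong K^n$ for some positive integer $n$.
   Context: All rings are commutative, unital and nonzero. A ring extension $R\subseteq S$ is: SL (strongly local) if $\mathrm U(R)=\mathrm U(S)$, where $\mathrm U$ denotes the group of units; strongly inert if for all nonzero $a,b\in S$, $ab\in R$ implies $a,b\in R$; weakly strongly inert if for all nonzero $a,b\in S$, $ab\in R\setminus\{0\}$ implies $a,b\in R$; FCP if each chain of $R$-subalgebras of $S$ is finite. *)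

theory Defs
  imports "HOL-Algebra.Finite_Extensions" "HOL-Algebra.Chinese_Remainder" "HOL-Algebra.IntRing"
begin

text \<open>
  A ring extension is given by a commutative ring \<open>S\<close> together with a subring \<open>R\<close> of \<open>S\<close>,
  the latter being a subset of the carrier; \<open>S\<lparr>carrier := R\<rparr>\<close> is that subring as a ring.
\<close>

definition strongly_local :: "'a set \<Rightarrow> ('a, 'b) ring_scheme \<Rightarrow> bool" where
  "strongly_local R S \<longleftrightarrow> Units (S\<lparr>carrier := R\<rparr>) = Units S"

definition strongly_inert :: "'a set \<Rightarrow> ('a, 'b) ring_scheme \<Rightarrow> bool" where
  "strongly_inert R S \<longleftrightarrow>
     (\<forall>a \<in> carrier S - {\<zero>\<^bsub>S\<^esub>}. \<forall>b \<in> carrier S - {\<zero>\<^bsub>S\<^esub>}.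
        a \<otimes>\<^bsub>S\<^esub> b \<in> R \<longrightarrow> a \<in> R \<and> b \<in> R)"

definition weakly_strongly_inert :: "'a set \<Rightarrow> ('a, 'b) ring_scheme \<Rightarrow> bool" where
  "weakly_strongly_inert R S \<longleftrightarrow>
     (\<forall>a \<in> carrier S - {\<zero>\<^bsub>S\<^esub>}. \<forall>b \<in> carrier S - {\<zero>\<^bsub>S\<^esub>}.
        a \<otimes>\<^bsub>S\<^esub> b \<in> R - {\<zero>\<^bsub>S\<^esub>} \<longrightarrow> a \<in> R \<and> b \<in> R)"

text \<open>
  The \<open>R\<close>-subalgebras of \<open>S\<close> are unital, i.e. the intermediate rings of the extension. The library
  predicate \<^const>\<open>subalgebra\<close> does not require the unit and also admits, for example, ideals.
\<close>

definition intermediate_rings :: "'a set \<Rightarrow> ('a, 'b) ring_scheme \<Rightarrow> 'a set set" where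
  "intermediate_rings R S = {T. subring T S \<and> R \<subseteq> T}"

definition FCP :: "'a set \<Rightarrow> ('a, 'b) ring_scheme \<Rightarrow> bool" where
  "FCP R S \<longleftrightarrow> (\<forall>\<C>. subset.chain (intermediate_rings R S) \<C> \<longrightarrow> finite \<C>)"

definition algebraically_closed_in :: "'a set \<Rightarrow> ('a, 'b) ring_scheme \<Rightarrow> bool" where
  "algebraically_closed_in K S \<longleftrightarrow>
     (\<forall>x \<in> carrier S. (ring.algebraic S over K) x \<longrightarrow> x \<in> K)"

end

theory Submission
  imports Defs
begin

text \<open>
  Write \<open>U\<close> for the group of units of \<open>S\<close>; SL says that \<open>U\<close> lies in \<open>K\<close>. Such an \<open>S\<close> is reduced,
  because \<open>1 + z\<close> is a unit when \<open>z\<^sup>2 = 0\<close>. Under FCP the chain of the rings \<open>K + y\<^sup>n S\<close> stabilises, which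
  yields \<open>y\<^sup>n = y\<^sup>n\<^sup>+\<^sup>1 s\<close> unless \<open>y\<close> is a unit. By reducedness \<open>e = y s\<close> is then an idempotent with
  \<open>y = y e\<close>, and \<open>y + (1 - e)\<close> is a unit, so \<open>y\<close> is a scalar \<open>k\<close> times \<open>e\<close>. If \<open>e\<close> is neither \<open>0\<close> nor \<open>1\<close>,
  the unit \<open>k e + (1 - e)\<close> can lie in \<open>K\<close> only for \<open>k = 1\<close>. Hence \<open>K \<noteq> S\<close> forces \<open>K = {0, 1}\<close> and \<open>S\<close>
  Boolean. A maximal finite intermediate ring is then all of \<open>S\<close>, and the atoms of the finite
  Boolean ring \<open>S\<close> give the coordinates of the isomorphism with a power of \<open>K\<close>.
\<close>

section \<open>Adjunction of one element and descending chains of powers\<close>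

text \<open>The relation \<open>x \<otimes> x = x \<otimes> c\<close> absorbs the quadratic term of
  a product into \<open>x U\<close>. The lemma serves twice: for \<open>K + y^(n+1) R\<close>, with
  \<open>c = x\<close>, and for \<open>M + x M\<close> with \<open>x\<close> idempotent, where
  \<open>c = \<one>\<close>.\<close>

lemma (in cring) subring_adjoin:
  assumes T: "subring T R" and U: "subring U R" and "T \<subseteq> U"
    and x: "x \<in> carrier R" and c: "c \<in> U" and xx: "x \<otimes> x = x \<otimes> c"
  shows "subring {a \<oplus> x \<otimes> b | a b. a \<in> T \<and> b \<in> U} R" (is "subring ?A R")
proof (rule subringI)
  note T' = subringE[OF T] and U' = subringE[OF U]
  have TU: "a \<in> U" if "a \<in> T" for a using that \<open>T \<subseteq> U\<close> by auto
  have TR: "a \<in> carrier R" if "a \<in> T" for a using that T'(1) by auto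
  have UR: "a \<in> carrier R" if "a \<in> U" for a using that U'(1) by auto
  show "?A \<subseteq> carrier R" using TR UR x by auto
  have "\<one> = \<one> \<oplus> x \<otimes> \<zero>" using x by simp
  then show "\<one> \<in> ?A" using T'(3) U'(2) by blast
  fix h1 assume "h1 \<in> ?A"
  then obtain a b where h1: "h1 = a \<oplus> x \<otimes> b" "a \<in> T" "b \<in> U" by auto
  note ab = TR[OF h1(2)] UR[OF h1(3)]
  have "\<ominus> h1 = \<ominus> a \<oplus> x \<otimes> (\<ominus> b)" using h1 ab x by (simp add: minus_add r_minus)
  then show "\<ominus> h1 \<in> ?A" using T'(5) U'(5) h1 by blast
  fix h2 assume "h2 \<in> ?A"
  then obtain a' b' where h2: "h2 = a' \<oplus> x \<otimes> b'" "a' \<in> T" "b' \<in> U" by auto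
  note ab' = TR[OF h2(2)] UR[OF h2(3)]
  have "h1 \<oplus> h2 = (a \<oplus> a') \<oplus> x \<otimes> (b \<oplus> b')"
    unfolding h1 h2 using ab ab' x by algebra
  then show "h1 \<oplus> h2 \<in> ?A" using T'(7) U'(7) h1 h2 by blast
  have cR: "c \<in> carrier R" using c UR by simp
  have "h1 \<otimes> h2 = a \<otimes> a' \<oplus> (x \<otimes> (a \<otimes> b' \<oplus> b \<otimes> a') \<oplus> (x \<otimes> x) \<otimes> (b \<otimes> b'))"
    unfolding h1 h2 using ab ab' x by algebra
  also have "\<dots> = a \<otimes> a' \<oplus> x \<otimes> (a \<otimes> b' \<oplus> b \<otimes> a' \<oplus> c \<otimes> (b \<otimes> b'))"
    unfolding xx using ab ab' x cR by algebra
  finally have "h1 \<otimes> h2 = a \<otimes> a' \<oplus> x \<otimes> (a \<otimes> b' \<oplus> b \<otimes> a' \<oplus> c \<otimes> (b \<otimes> b'))" .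
  moreover have "a \<otimes> b' \<oplus> b \<otimes> a' \<oplus> c \<otimes> (b \<otimes> b') \<in> U"
    using TU h1 h2 c by (intro U'(6,7)) auto
  ultimately show "h1 \<otimes> h2 \<in> ?A"
    using T'(6)[OF h1(2) h2(2)] by blast
qed

text \<open>The rings \<open>K + y^(n+1) R\<close> form a descending chain, so under FCP two of them
  coincide, and the generator of one already lies in the next.\<close>

lemma (in cring) FCP_power_stable:
  assumes K: "subring K R" and FCP: "FCP K R" and y: "y \<in> carrier R"
  obtains n k s where "k \<in> K" "s \<in> carrier R" "y [^] Suc n = k \<oplus> y [^] Suc (Suc n) \<otimes> s"
proof -
  \<comment> \<open>The exponent starts at 1 so that \<open>y\<close> divides each generator; for
    exponent 0 the relation \<open>1 = 1 + y 0\<close> would hold trivially and say nothing about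
    \<open>y\<close>.\<close>
  define T where "T n = {a \<oplus> y [^] Suc n \<otimes> b | a b. a \<in> K \<and> b \<in> carrier R}" for n :: nat
  have KR: "K \<subseteq> carrier R" using subringE(1)[OF K] .
  have T: "subring (T n) R" for n
    unfolding T_def
    by (rule subring_adjoin[OF K carrier_is_subring KR]) (use y in auto)
  have KT: "K \<subseteq> T n" for n
  proof
    fix a assume "a \<in> K"
    then have "a = a \<oplus> y [^] Suc n \<otimes> \<zero>" using KR y by auto
    then show "a \<in> T n" unfolding T_def using \<open>a \<in> K\<close> by blast
  qed
  have anti: "T n \<subseteq> T m" if "m \<le> n" for m n
  proof
    fix z assume "z \<in> T n"
    then obtain a b where z: "z = a \<oplus> y [^] Suc n \<otimes> b" "a \<in> K" "b \<in> carrier R"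
      unfolding T_def by auto
    have "Suc m + (n - m) = Suc n" using that by simp
    then have "y [^] Suc n = y [^] Suc m \<otimes> y [^] (n - m)"
      using nat_pow_mult[OF y, of "Suc m" "n - m"] by (simp only:)
    then have "z = a \<oplus> y [^] Suc m \<otimes> (y [^] (n - m) \<otimes> b)"
      using z m_assoc[OF nat_pow_closed nat_pow_closed, OF y y, of b "Suc m" "n - m"] by (simp only:)
    then show "z \<in> T m" unfolding T_def using z y by blast
  qed
  have "subset.chain (intermediate_rings K R) (range T)"
  proof -
    have "T m \<subseteq> T n \<or> T n \<subseteq> T m" for m n
      using anti linear[of m n] by blast
    then show ?thesis
      unfolding subset_chain_def intermediate_rings_def using T KT by blast
  qed
  then have "finite (range T)" using FCP unfolding FCP_def by blast
  then have "\<not> inj T" using finite_imageD by blast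
  then obtain m n where "m < n" "T m = T n" unfolding inj_def by (metis nat_neq_iff)
  \<comment> \<open>Since \<open>Suc m \<le> n\<close>, the ring \<open>T (Suc m)\<close> contains
    \<open>T n = T m\<close>.\<close>
  then have "T m \<subseteq> T (Suc m)" using anti[of "Suc m" n] by auto
  moreover have "y [^] Suc m = \<zero> \<oplus> y [^] Suc m \<otimes> \<one>" using y by simp
  then have "y [^] Suc m \<in> T m" unfolding T_def using subringE(2)[OF K] by blast
  ultimately show thesis using that unfolding T_def by blast
qed

section \<open>Reducedness and regular elements\<close>

text \<open>The defect \<open>d = y - y^2 s\<close> equals \<open>y (1 - y s)\<close>. Hence
  \<open>d^n\<close> is a multiple of \<open>y^n\<close>, while \<open>y^n\<close> annihilates
  \<open>d\<close> by \<open>reg\<close>; so \<open>d^(n+1) = 0\<close>, and \<open>red\<close>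
  gives \<open>d = 0\<close>.\<close>

lemma (in cring) reduced_strongly_regular:
  assumes y: "y \<in> carrier R" and s: "s \<in> carrier R"
    and reg: "y [^] n = y [^] Suc n \<otimes> s"
    and red: "\<And>x m. x \<in> carrier R \<Longrightarrow> x [^] (m::nat) = \<zero> \<Longrightarrow> x = \<zero>"
  shows "y = y \<otimes> (y \<otimes> s)"
proof -
  define d where "d = y \<ominus> y \<otimes> (y \<otimes> s)"
  have d: "d \<in> carrier R" unfolding d_def using y s by simp
  have "y [^] n \<otimes> d = (y [^] n \<ominus> y [^] Suc n \<otimes> s) \<otimes> y"
    unfolding d_def nat_pow_Suc using y s nat_pow_closed[OF y, of n] by algebra
  also have "\<dots> = \<zero>" using reg y s by (simp add: r_neg minus_eq)
  finally have yd: "y [^] n \<otimes> d = \<zero>" .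
  have "d = y \<otimes> (\<one> \<ominus> y \<otimes> s)" unfolding d_def using y s by algebra
  then have dn: "d [^] n = y [^] n \<otimes> (\<one> \<ominus> y \<otimes> s) [^] n"
    using y s by (simp add: nat_pow_distrib)
  have u: "(\<one> \<ominus> y \<otimes> s) [^] n \<in> carrier R" using y s by simp
  have "d [^] Suc n = (y [^] n \<otimes> d) \<otimes> (\<one> \<ominus> y \<otimes> s) [^] n"
    using y d u by (simp add: dn m_ac)
  also have "\<dots> = \<zero>" using yd u by simp
  finally have "d [^] Suc n = \<zero>" .
  then have "d = \<zero>" using red d by blast
  then show ?thesis unfolding d_def using y s by (metis d_def m_closed r_right_minus_eq)
qed

lemma (in comm_monoid) Units_right_inverseI:
  assumes "u \<in> carrier G" "v \<in> carrier G" "u \<otimes> v = \<one>"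
  shows "u \<in> Units G"
  using assms m_comm[of u v] unfolding Units_def by auto

text \<open>If \<open>z^2 = 0\<close>, then \<open>(1 + z)(1 - z) = 1\<close>, so
  \<open>1 + z\<close> and hence \<open>z\<close> lies in the field \<open>K\<close>, where an
  element of square zero vanishes. Higher powers reduce to this case.\<close>

lemma (in cring) strongly_local_reduced:
  assumes K: "subfield K R" and U: "Units R \<subseteq> K"
    and x: "x \<in> carrier R" and nil: "x [^] (m::nat) = \<zero>"
  shows "x = \<zero>"
proof -
  note K' = subringE[OF subfieldE(1)[OF K]]
  have square: "z = \<zero>" if z: "z \<in> carrier R" "z \<otimes> z = \<zero>" for z
  proof (rule ccontr)
    assume "z \<noteq> \<zero>"
    have "(\<one> \<oplus> z) \<otimes> (\<one> \<ominus> z) = \<one> \<ominus> z \<otimes> z" using z(1) by algebra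
    then have "(\<one> \<oplus> z) \<otimes> (\<one> \<ominus> z) = \<one>" using z by (simp add: minus_eq)
    then have "\<one> \<oplus> z \<in> Units R"
      using z(1) by (intro Units_right_inverseI[of _ "\<one> \<ominus> z"]) auto
    then have "(\<one> \<oplus> z) \<oplus> \<ominus> \<one> \<in> K" using U K'(3,5,7) by blast
    moreover have "(\<one> \<oplus> z) \<oplus> \<ominus> \<one> = z" using z(1) by algebra
    ultimately have zK: "z \<in> K - {\<zero>}" using \<open>z \<noteq> \<zero>\<close> by simp
    have "inv z \<in> carrier R" using subfield_m_inv(1)[OF K zK] K'(1) by auto
    then have "z = inv z \<otimes> (z \<otimes> z)"
      using z(1) subfield_m_inv(3)[OF K zK] by (simp flip: m_assoc)
    then show False using z \<open>inv z \<in> carrier R\<close> \<open>z \<noteq> \<zero>\<close> by simp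
  qed
  have pow_Suc: "x = \<zero>" if "x [^] Suc n = \<zero>" for n
    using that
  proof (induction n)
    case 0
    then show ?case using x by simp
  next
    case (Suc n)
    \<comment> \<open>The square of \<open>x^(n+1)\<close> is \<open>x^(n+2) x^n = 0\<close>, so the
      square case lowers the vanishing exponent by one.\<close>
    have "x [^] Suc n \<otimes> x [^] Suc n = x [^] Suc (Suc n) \<otimes> x [^] n"
      using nat_pow_mult[OF x, of "Suc n" "Suc n"] nat_pow_mult[OF x, of "Suc (Suc n)" n]
      by (simp only: add_Suc add_Suc_right)
    also have "\<dots> = \<zero>" using Suc.prems x by (simp only: l_null nat_pow_closed)
    finally have "x [^] Suc n = \<zero>" using square x by blast
    then show ?case using Suc.IH by blast
  qed
  show ?thesis
  proof (cases m)
    case 0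
    \<comment> \<open>Here \<open>nil\<close> reads \<open>\<one> = \<zero>\<close>, which a
      subfield excludes.\<close>
    then show ?thesis using nil subfieldE(6)[OF K] by simp
  next
    case (Suc n)
    then show ?thesis using nil pow_Suc by blast
  qed
qed

section \<open>Scalars and idempotents under strong locality\<close>

lemma (in ring) subfield_mult_cancel:
  assumes K: "subfield K R" and k: "k \<in> K" and x: "x \<in> carrier R" and "k \<otimes> x = \<zero>" "x \<noteq> \<zero>"
  shows "k = \<zero>"
proof (rule ccontr)
  assume "k \<noteq> \<zero>"
  with k have k': "k \<in> K - {\<zero>}" by simp
  have "inv k \<in> carrier R" "k \<in> carrier R"
    using subfield_m_inv(1)[OF K k'] subfieldE(3)[OF K] k by auto
  then have "x = inv k \<otimes> (k \<otimes> x)"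
    using subfield_m_inv(3)[OF K k'] x by (simp flip: m_assoc)
  then show False using assms \<open>inv k \<in> carrier R\<close> by simp
qed

text \<open>The relation from the stable power chain is split by its scalar term. If that term is
  zero, \<open>e = y s\<close> is idempotent with \<open>y = y e\<close>, and some unit, necessarily
  a scalar, agrees with \<open>y\<close> on \<open>e R\<close>. If it is nonzero, \<open>y\<close>
  is itself a unit and \<open>e = 1\<close> works.\<close>

lemma (in cring) strongly_local_FCP_scaled_idempotent:
  assumes K: "subfield K R" and U: "Units R \<subseteq> K" and FCP: "FCP K R" and y: "y \<in> carrier R"
  obtains k e where "k \<in> K - {\<zero>}" "e \<in> carrier R" "e \<otimes> e = e" "y = k \<otimes> e"
proof -
  note K' = subringE[OF subfieldE(1)[OF K]]
  have one: "\<one> \<noteq> \<zero>" using subfieldE(6)[OF K] .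
  have unitI: "u \<in> K - {\<zero>}" if "u \<in> carrier R" "v \<in> carrier R" "u \<otimes> v = \<one>" for u v
  proof -
    have "u \<in> Units R" using that by (rule Units_right_inverseI)
    moreover have "u \<noteq> \<zero>" using that one by auto
    ultimately show ?thesis using U by blast
  qed
  obtain n k s where k: "k \<in> K" and s: "s \<in> carrier R"
    and eq: "y [^] Suc n = k \<oplus> y [^] Suc (Suc n) \<otimes> s"
    using FCP_power_stable[OF subfieldE(1)[OF K] FCP y] by blast
  have kR: "k \<in> carrier R" using k K'(1) by auto
  show thesis
  proof (cases "k = \<zero>")
    case True
    then have "y [^] Suc n = y [^] Suc (Suc n) \<otimes> s"
      using eq y s by (simp only: l_zero m_closed nat_pow_closed)
    then have ye: "y = y \<otimes> (y \<otimes> s)"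
      using reduced_strongly_regular[OF y s] strongly_local_reduced[OF K U] by blast
    define e where "e = y \<otimes> s"
    have e: "e \<in> carrier R" unfolding e_def using y s by simp
    have ye': "y \<otimes> e = y" using ye unfolding e_def by simp
    have "e \<otimes> e = (y \<otimes> e) \<otimes> s" unfolding e_def using y s by algebra
    then have ee: "e \<otimes> e = e" using ye' unfolding e_def by simp
    \<comment> \<open>The inverse is found componentwise: the element acts on \<open>e R\<close> as
      \<open>y\<close>, with inverse \<open>e s\<close>, and on \<open>(1 - e) R\<close> as the
      identity.\<close>
    have "(y \<oplus> (\<one> \<ominus> e)) \<otimes> (e \<otimes> s \<oplus> (\<one> \<ominus> e)) =
        (y \<otimes> s) \<otimes> e \<oplus> (y \<ominus> y \<otimes> e) \<oplus> (e \<ominus> e \<otimes> e) \<otimes> s \<oplus> (\<one> \<ominus> e \<ominus> (e \<ominus> e \<otimes> e))"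
      using e y s by algebra
    also have "\<dots> = e \<oplus> (\<one> \<ominus> e)"
      unfolding ye' e_def[symmetric] ee using e y s by algebra
    also have "\<dots> = \<one>" using e by algebra
    finally have "y \<oplus> (\<one> \<ominus> e) \<in> K - {\<zero>}" using e y s by (intro unitI) auto
    \<comment> \<open>Multiplication by \<open>e\<close> removes the summand \<open>1 - e\<close>,
      so the scalar \<open>y + (1 - e)\<close> times \<open>e\<close> is \<open>y\<close>.\<close>
    moreover have "(y \<oplus> (\<one> \<ominus> e)) \<otimes> e = y \<otimes> e \<oplus> (e \<ominus> e \<otimes> e)" using e y by algebra
    then have "y = (y \<oplus> (\<one> \<ominus> e)) \<otimes> e" unfolding ye' ee using y e by (simp add: minus_eq r_neg)
    ultimately show thesis using that e ee by blast
  next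
    case False
    then have k': "k \<in> K - {\<zero>}" using k by simp
    define p where "p = y [^] n"
    have p: "p \<in> carrier R" unfolding p_def using y by simp
    \<comment> \<open>As \<open>q\<close> is \<open>y^(n+2) s\<close>, the product
      \<open>y p (1 - y s)\<close> equals \<open>y^(n+1) - q = k\<close>; thus \<open>y\<close>
      divides a nonzero scalar.\<close>
    define q where "q = (p \<otimes> y \<otimes> y) \<otimes> s"
    have q: "q \<in> carrier R" unfolding q_def using p y s by simp
    have "p \<otimes> y = k \<oplus> q" using eq unfolding p_def q_def nat_pow_Suc .
    moreover have "(k \<oplus> q) \<ominus> q = k" using q kR by algebra
    moreover have "y \<otimes> (p \<otimes> (\<one> \<ominus> y \<otimes> s)) = p \<otimes> y \<ominus> q"
      unfolding q_def using p y s by algebra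
    ultimately have "y \<otimes> (p \<otimes> (\<one> \<ominus> y \<otimes> s)) = k" by simp
    moreover have ik: "inv k \<in> carrier R" using subfield_m_inv(1)[OF K k'] K'(1) by auto
    ultimately have "y \<otimes> ((p \<otimes> (\<one> \<ominus> y \<otimes> s)) \<otimes> inv k) = \<one>"
      using subfield_m_inv(2)[OF K k'] p y s by (simp flip: m_assoc)
    then have "y \<in> K - {\<zero>}" using p y s ik by (intro unitI) auto
    then show thesis using that[of y \<one>] y by simp
  qed
qed

text \<open>The element \<open>u = k e + (1 - e)\<close> is a unit, with inverse
  \<open>l e + (1 - e)\<close>, and therefore a scalar. On \<open>e R\<close> it acts as
  \<open>k\<close>, which forces \<open>u = k\<close>; on \<open>(1 - e) R\<close> it acts as
  \<open>1\<close>, which then forces \<open>k = 1\<close>.\<close>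

lemma (in cring) strongly_local_nontrivial_idempotent:
  assumes K: "subfield K R" and U: "Units R \<subseteq> K"
    and e: "e \<in> carrier R" "e \<otimes> e = e" "e \<noteq> \<zero>" "e \<noteq> \<one>" and k: "k \<in> K - {\<zero>}"
  shows "k = \<one>"
proof -
  note K' = subringE[OF subfieldE(1)[OF K]]
  define l where "l = inv k"
  have l: "l \<in> carrier R" "k \<otimes> l = \<one>" and kR: "k \<in> carrier R"
    unfolding l_def using subfield_m_inv[OF K k] K'(1) k by auto
  define u where "u = k \<otimes> e \<oplus> (\<one> \<ominus> e)"
  have uR: "u \<in> carrier R" unfolding u_def using kR e by simp
  have "u \<otimes> (l \<otimes> e \<oplus> (\<one> \<ominus> e)) =
      (k \<otimes> l) \<otimes> (e \<otimes> e) \<oplus> (k \<oplus> l) \<otimes> (e \<ominus> e \<otimes> e) \<oplus> (\<one> \<ominus> e \<ominus> (e \<ominus> e \<otimes> e))"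
    unfolding u_def using kR e(1) l(1) by algebra
  also have "\<dots> = \<one>" unfolding e(2) l(2) using kR e(1) l(1) by algebra
  finally have "u \<in> Units R" using uR l e by (intro Units_right_inverseI) auto
  then have u: "u \<in> K" using U by blast
  have "(u \<ominus> k) \<otimes> e = (k \<ominus> \<one>) \<otimes> (e \<otimes> e \<ominus> e)" unfolding u_def using kR e(1) by algebra
  also have "\<dots> = \<zero>" unfolding e(2) using kR e(1) by algebra
  finally have "u \<ominus> k = \<zero>"
    using subfield_mult_cancel[OF K _ e(1) _ e(3)] u k K'(5,7) by (simp add: minus_eq)
  then have uk: "u = k" using uR kR by simp
  have e1: "\<one> \<ominus> e \<noteq> \<zero>" using e by (metis one_closed r_right_minus_eq)
  have "(k \<ominus> \<one>) \<otimes> (\<one> \<ominus> e) = k \<ominus> u" unfolding u_def using kR e(1) by algebra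
  also have "\<dots> = \<zero>" unfolding uk using kR by algebra
  finally have "k \<ominus> \<one> = \<zero>"
    using subfield_mult_cancel[OF K _ _ _ e1] e(1) k K'(3,5,7) by (simp add: minus_eq)
  then show ?thesis using kR by simp
qed

text \<open>An element outside \<open>K\<close> is a scalar multiple of an idempotent, which then
  lies outside \<open>K\<close> too and is neither 0 nor 1. Its existence forces every nonzero
  scalar to be 1, so every element is an idempotent.\<close>

lemma (in cring) strongly_local_FCP_boolean:
  assumes K: "subfield K R" and U: "Units R \<subseteq> K" and FCP: "FCP K R" and ne: "K \<noteq> carrier R"
  shows "K = {\<zero>, \<one>}" and "\<forall>x \<in> carrier R. x \<otimes> x = x"
proof -
  note K' = subringE[OF subfieldE(1)[OF K]]
  obtain y where y: "y \<in> carrier R" "y \<notin> K" using ne K'(1) by blast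
  obtain k e where e: "k \<in> K - {\<zero>}" "e \<in> carrier R" "e \<otimes> e = e" "y = k \<otimes> e"
    using strongly_local_FCP_scaled_idempotent[OF K U FCP y(1)] by blast
  have "e \<notin> K" using e y(2) K'(6) by blast
  then have "e \<noteq> \<zero>" "e \<noteq> \<one>" using K'(2,3) by auto
  then have one: "k = \<one>" if "k \<in> K - {\<zero>}" for k
    using strongly_local_nontrivial_idempotent[OF K U e(2,3) _ _ that] by blast
  then show "K = {\<zero>, \<one>}" using K'(2,3) by auto
  show "\<forall>x \<in> carrier R. x \<otimes> x = x"
  proof
    fix x assume x: "x \<in> carrier R"
    obtain k e where e: "k \<in> K - {\<zero>}" "e \<in> carrier R" "e \<otimes> e = e" "x = k \<otimes> e"
      using strongly_local_FCP_scaled_idempotent[OF K U FCP x] by blast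
    then show "x \<otimes> x = x" using one[OF e(1)] by simp
  qed
qed

section \<open>Finiteness of Boolean rings under FCP\<close>

text \<open>Zorn's lemma applies to the finite intermediate rings because FCP makes their chains
  finite. A maximal \<open>M\<close> contains every \<open>x\<close>, since \<open>M + x M\<close>
  is again a finite ring when \<open>x\<close> is idempotent.\<close>

lemma (in cring) FCP_boolean_finite:
  assumes K: "subring K R" "finite K" and FCP: "FCP K R"
    and idem: "\<And>x. x \<in> carrier R \<Longrightarrow> x \<otimes> x = x"
  shows "finite (carrier R)"
proof -
  define \<A> where "\<A> = {T \<in> intermediate_rings K R. finite T}"
  have "\<exists>M \<in> \<A>. \<forall>T \<in> \<A>. M \<subseteq> T \<longrightarrow> T = M"
  proof (rule subset_Zorn_nonempty)
    show "\<A> \<noteq> {}" using K unfolding \<A>_def intermediate_rings_def by blast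
    fix \<C> assume "\<C> \<noteq> {}" and chain: "subset.chain \<A> \<C>"
    then have "subset.chain (intermediate_rings K R) \<C>"
      unfolding \<A>_def subset_chain_def by blast
    then have "finite \<C>" using FCP unfolding FCP_def by blast
    \<comment> \<open>A finite nonempty chain contains its union as its largest member.\<close>
    then have "\<Union>\<C> \<in> \<C>" using Union_in_chain \<open>\<C> \<noteq> {}\<close> chain by blast
    then show "\<Union>\<C> \<in> \<A>" using chain unfolding subset_chain_def by blast
  qed
  then obtain M where "M \<in> \<A>" and max: "\<And>T. T \<in> \<A> \<Longrightarrow> M \<subseteq> T \<Longrightarrow> T = M" by blast
  then have M: "subring M R" "K \<subseteq> M" "finite M" unfolding \<A>_def intermediate_rings_def by auto
  note M' = subringE[OF M(1)]
  have "x \<in> M" if x: "x \<in> carrier R" for x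
  proof -
    define T where "T = {a \<oplus> x \<otimes> b | a b. a \<in> M \<and> b \<in> M}"
    have "subring T R"
      unfolding T_def by (rule subring_adjoin[OF M(1) M(1) _ x M'(3)]) (use idem x in auto)
    moreover have "T = (\<lambda>(a, b). a \<oplus> x \<otimes> b) ` (M \<times> M)" unfolding T_def by auto
    then have "finite T" using M(3) by simp
    moreover have MT: "M \<subseteq> T"
    proof
      fix a assume "a \<in> M"
      then have "a = a \<oplus> x \<otimes> \<zero>" using M'(1) x by auto
      then show "a \<in> T" unfolding T_def using \<open>a \<in> M\<close> M'(2) by blast
    qed
    ultimately have "T = M" using max M(2) unfolding \<A>_def intermediate_rings_def by blast
    moreover have "x = \<zero> \<oplus> x \<otimes> \<one>" using x by simp
    then have "x \<in> T" unfolding T_def using M'(2,3) by blast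
    ultimately show ?thesis by simp
  qed
  then have "carrier R \<subseteq> M" by (rule subsetI)
  then show ?thesis using M(3) by (rule finite_subset)
qed

section \<open>Isomorphism with a power of the field\<close>

lemma ring_hom_map_RDirProd_list:
  assumes "\<And>f. f \<in> set fs \<Longrightarrow> f \<in> ring_hom R S"
  shows "(\<lambda>x. map (\<lambda>f. f x) fs) \<in> ring_hom R (RDirProd_list (replicate (length fs) S))"
  using assms
proof (induction fs)
  case Nil
  show ?case by (auto simp: ring_hom_def monoid.defs)
next
  case (Cons f fs)
  \<comment> \<open>The map is the diagonal, followed by the product of \<open>f\<close> with the
    inductive map, followed by prepending the head to the list.\<close>
  have "(\<lambda>(a, as). a # as) \<circ> ((\<lambda>(r, s). (f r, map (\<lambda>f. f s) fs)) \<circ> (\<lambda>a. (a, a)))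
      \<in> ring_hom R (RDirProd_list (S # replicate (length fs) S))"
    using Cons by (intro ring_hom_trans[OF _ RDirProd_list_hom1] ring_hom_trans[OF RDirProd_hom1]
        RDirProd_hom3) auto
  then show ?case by (simp add: comp_def)
qed

text \<open>The coordinate of \<open>x\<close> at \<open>e\<close> is the scalar \<open>k\<close>
  with \<open>x e = k e\<close>. Coordinates are ring homomorphisms, \<open>sep\<close> makes them
  jointly injective, and \<open>orth\<close> lets them be prescribed independently.\<close>

lemma (in cring) iso_power_of_orthogonal_idempotents:
  assumes K: "subfield K R" and "distinct es"
    and es: "\<And>e. e \<in> set es \<Longrightarrow> e \<in> carrier R \<and> e \<noteq> \<zero> \<and> e \<otimes> e = e"
    and orth: "\<And>e f. e \<in> set es \<Longrightarrow> f \<in> set es \<Longrightarrow> e \<noteq> f \<Longrightarrow> e \<otimes> f = \<zero>"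
    and scalar: "\<And>e x. e \<in> set es \<Longrightarrow> x \<in> carrier R \<Longrightarrow> \<exists>k \<in> K. x \<otimes> e = k \<otimes> e"
    and sep: "\<And>x. x \<in> carrier R \<Longrightarrow> (\<And>e. e \<in> set es \<Longrightarrow> x \<otimes> e = \<zero>) \<Longrightarrow> x = \<zero>"
  shows "R \<simeq> RDirProd_list (replicate (length es) (R\<lparr>carrier := K\<rparr>))"
proof -
  note K' = subringE[OF subfieldE(1)[OF K]]
  have KR: "k \<in> carrier R" if "k \<in> K" for k using that K'(1) by auto
  have uniq: "k = l" if "e \<in> set es" "k \<in> K" "l \<in> K" "k \<otimes> e = l \<otimes> e" for e k l
  proof -
    have e: "e \<in> carrier R" "e \<noteq> \<zero>" using es that(1) by auto
    have "(k \<ominus> l) \<otimes> e = k \<otimes> e \<ominus> l \<otimes> e" using KR e that(2,3) by algebra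
    also have "\<dots> = \<zero>" using that(3,4) KR e by (simp add: minus_eq r_neg)
    finally have kl: "(k \<ominus> l) \<otimes> e = \<zero>" .
    have "k \<ominus> l \<in> K" unfolding minus_eq using that K'(5,7) by blast
    then have "k \<ominus> l = \<zero>" using subfield_mult_cancel[OF K _ e(1) kl e(2)] by blast
    then show ?thesis using that KR by simp
  qed
  define c where "c e x = (THE k. k \<in> K \<and> x \<otimes> e = k \<otimes> e)" for e x
  have c: "c e x \<in> K \<and> x \<otimes> e = c e x \<otimes> e" if "e \<in> set es" "x \<in> carrier R" for e x
  proof -
    obtain k where "k \<in> K" "x \<otimes> e = k \<otimes> e" using scalar[OF \<open>e \<in> set es\<close> \<open>x \<in> carrier R\<close>] by blast
    then have "\<exists>!k. k \<in> K \<and> x \<otimes> e = k \<otimes> e"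
      using uniq[OF \<open>e \<in> set es\<close>, of _ k] by (intro ex1I[of _ k]) auto
    then show ?thesis unfolding c_def by (rule theI')
  qed
  have cI: "c e x = k" if "e \<in> set es" "x \<in> carrier R" "k \<in> K" "x \<otimes> e = k \<otimes> e" for e x k
    by (rule uniq[OF that(1) _ that(3)]) (use c[OF that(1,2)] that(4) in auto)
  have c_hom: "c e \<in> ring_hom R (R\<lparr>carrier := K\<rparr>)" if e: "e \<in> set es" for e
  proof (rule ring_hom_memI)
    have eR: "e \<in> carrier R" "e \<otimes> e = e" using es e by auto
    show "c e \<one> = \<one>\<^bsub>R\<lparr>carrier := K\<rparr>\<^esub>" using cI[OF e _ K'(3)] by simp
    fix x assume x: "x \<in> carrier R"
    show "c e x \<in> carrier (R\<lparr>carrier := K\<rparr>)" using c[OF e x] by simp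
    fix y assume y: "y \<in> carrier R"
    note cx = c[OF e x] and cy = c[OF e y]
    note cR = KR[OF conjunct1[OF cx]] KR[OF conjunct1[OF cy]]
    have "(x \<oplus> y) \<otimes> e = (c e x \<oplus> c e y) \<otimes> e" using cx cy cR x y eR by (simp add: l_distr)
    then show "c e (x \<oplus> y) = c e x \<oplus>\<^bsub>R\<lparr>carrier := K\<rparr>\<^esub> c e y"
      using cI[OF e, of "x \<oplus> y" "c e x \<oplus> c e y"] K'(7) cx cy x y by simp
    have "(x \<otimes> y) \<otimes> e = x \<otimes> (y \<otimes> e)" using x y eR by (simp add: m_assoc)
    also have "\<dots> = (x \<otimes> e) \<otimes> c e y" using cy cR x eR by (simp add: m_ac)
    also have "\<dots> = (c e x \<otimes> c e y) \<otimes> e" using cx cR x eR by (simp add: m_ac)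
    finally show "c e (x \<otimes> y) = c e x \<otimes>\<^bsub>R\<lparr>carrier := K\<rparr>\<^esub> c e y"
      using cI[OF e, of "x \<otimes> y" "c e x \<otimes> c e y"] K'(6) cx cy x y by simp
  qed
  define h where "h x = map (\<lambda>e. c e x) es" for x
  let ?P = "RDirProd_list (replicate (length es) (R\<lparr>carrier := K\<rparr>))"
  have h: "h \<in> ring_hom R ?P"
    using ring_hom_map_RDirProd_list[of "map c es" R "R\<lparr>carrier := K\<rparr>"] c_hom
    unfolding h_def by (auto simp: comp_def)
  have "x = y" if x: "x \<in> carrier R" and y: "y \<in> carrier R" and "h x = h y" for x y
  proof -
    have "(x \<ominus> y) \<otimes> e = \<zero>" if e: "e \<in> set es" for e
    proof -
      have "c e x = c e y" using \<open>h x = h y\<close> e unfolding h_def by simp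
      then have "x \<otimes> e = y \<otimes> e" using c[OF e x] c[OF e y] by simp
      moreover have "(x \<ominus> y) \<otimes> e = x \<otimes> e \<ominus> y \<otimes> e" using es[OF e] x y by algebra
      ultimately show ?thesis using es[OF e] y by (simp add: minus_eq r_neg)
    qed
    then have "x \<ominus> y = \<zero>" using sep x y by simp
    then show ?thesis using x y by simp
  qed
  then have "inj_on h (carrier R)" by (auto intro: inj_onI)
  moreover have "zs \<in> h ` carrier R" if zs: "zs \<in> carrier ?P" for zs
  proof -
    have len: "length es = length zs" using RDirProd_list_carrier_mem(1)[OF zs] by simp
    have zsK: "set zs \<subseteq> K"
      using RDirProd_list_carrier_mem(2)[OF zs] len by (auto simp: in_set_conv_nth)
    \<comment> \<open>For surjectivity, an element with coordinate list \<open>zs\<close> is built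
      by setting one coordinate at a time.\<close>
    have "\<exists>x \<in> carrier R. list_all2 (\<lambda>e z. x \<otimes> e = z \<otimes> e) es zs"
      using len \<open>distinct es\<close> es orth zsK
    proof (induction es zs rule: list_induct2)
      case Nil
      then show ?case by auto
    next
      case (Cons e es z zs)
      then obtain x where x: "x \<in> carrier R" "list_all2 (\<lambda>e z. x \<otimes> e = z \<otimes> e) es zs" by auto
      have e: "e \<in> carrier R" "e \<otimes> e = e" using Cons.prems by auto
      have z: "z \<in> carrier R" using Cons.prems KR by auto
      \<comment> \<open>\<open>x'\<close> has coordinate \<open>z\<close> at \<open>e\<close> and
        keeps the coordinates of \<open>x\<close> at every \<open>f\<close> orthogonal to
        \<open>e\<close>.\<close>
      define x' where "x' = x \<otimes> (\<one> \<ominus> e) \<oplus> z \<otimes> e"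
      have x': "x' \<in> carrier R" unfolding x'_def using x e z by simp
      have "x' \<otimes> e = x \<otimes> (e \<ominus> e \<otimes> e) \<oplus> z \<otimes> (e \<otimes> e)" unfolding x'_def using x(1) e(1) z by algebra
      also have "\<dots> = z \<otimes> e" unfolding e(2) using x(1) e(1) z by algebra
      finally have "x' \<otimes> e = z \<otimes> e" .
      moreover have "x' \<otimes> f = x \<otimes> f" if f: "f \<in> set es" for f
      proof -
        have fR: "f \<in> carrier R" and "e \<noteq> f" using Cons.prems f by auto
        then have ef: "e \<otimes> f = \<zero>" using Cons.prems f by simp
        have "x' \<otimes> f = x \<otimes> f \<oplus> (z \<ominus> x) \<otimes> (e \<otimes> f)" unfolding x'_def using x(1) e(1) z fR by algebra
        then show ?thesis unfolding ef using x z fR by simp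
      qed
      then have "list_all2 (\<lambda>e z. x' \<otimes> e = z \<otimes> e) es zs"
        using x(2) by (auto elim!: list_all2_mono[rotated] simp: list_all2_conv_all_nth)
      ultimately show ?case using x' by auto
    qed
    then obtain x where x: "x \<in> carrier R" "list_all2 (\<lambda>e z. x \<otimes> e = z \<otimes> e) es zs" by blast
    have "h x = zs"
    proof (rule nth_equalityI)
      show "length (h x) = length zs" unfolding h_def using len by simp
      fix i assume "i < length (h x)"
      then have "i < length es" "i < length zs" unfolding h_def using len by auto
      then have "c (es ! i) x = zs ! i"
        using x zsK by (intro cI) (auto simp: list_all2_conv_all_nth)
      then show "h x ! i = zs ! i" unfolding h_def using \<open>i < length es\<close> by simp
    qed
    then show ?thesis using x by blast
  qed
  moreover have "h ` carrier R \<subseteq> carrier ?P" using h unfolding ring_hom_def by auto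
  ultimately have "bij_betw h (carrier R) (carrier ?P)" unfolding bij_betw_def by blast
  then show ?thesis using h unfolding is_ring_iso_def ring_iso_def by blast
qed

text \<open>Induction on the size of the ideal \<open>x R\<close>: if some multiple
  \<open>y x\<close> is neither 0 nor \<open>x\<close>, it generates a strictly smaller nonzero
  ideal, and an atom below it is also below \<open>x\<close>.\<close>

lemma (in cring) boolean_atom_below:
  assumes fin: "finite (carrier R)" and idem: "\<And>x. x \<in> carrier R \<Longrightarrow> x \<otimes> x = x"
    and "x \<in> carrier R" "x \<noteq> \<zero>"
  obtains a where "a \<in> carrier R" "a \<noteq> \<zero>" "x \<otimes> a = a"
    "\<And>y. y \<in> carrier R \<Longrightarrow> y \<otimes> a \<in> {\<zero>, a}"
proof -
  have "\<exists>a. a \<in> carrier R \<and> a \<noteq> \<zero> \<and> x \<otimes> a = a \<and> (\<forall>y \<in> carrier R. y \<otimes> a \<in> {\<zero>, a})"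
    using \<open>x \<in> carrier R\<close> \<open>x \<noteq> \<zero>\<close>
  proof (induction "card ((\<otimes>) x ` carrier R)" arbitrary: x rule: less_induct)
    case less
    show ?case
    proof (cases "\<forall>y \<in> carrier R. y \<otimes> x \<in> {\<zero>, x}")
      case True
      then show ?thesis using less.prems idem by blast
    next
      case False
      then obtain y where y: "y \<in> carrier R" "y \<otimes> x \<noteq> \<zero>" "y \<otimes> x \<noteq> x" by blast
      define z where "z = y \<otimes> x"
      have x: "x \<in> carrier R" "x \<otimes> x = x" using less.prems idem by auto
      have z: "z \<in> carrier R" "z \<otimes> z = z" "z \<noteq> \<zero>" "z \<noteq> x" unfolding z_def using y x idem by auto
      have zx: "z \<otimes> x = z" unfolding z_def using x y by (simp add: m_assoc)
      have "(\<otimes>) z ` carrier R \<subset> (\<otimes>) x ` carrier R"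
      proof
        have "z \<otimes> s = x \<otimes> (y \<otimes> s)" if "s \<in> carrier R" for s
          unfolding z_def using x y that by algebra
        then show "(\<otimes>) z ` carrier R \<subseteq> (\<otimes>) x ` carrier R" using y by auto
        \<comment> \<open>Multiplication by \<open>z\<close> fixes every element of
          \<open>z R\<close>, whereas \<open>z x = z \<noteq> x\<close>.\<close>
        have "x \<notin> (\<otimes>) z ` carrier R"
        proof
          assume "x \<in> (\<otimes>) z ` carrier R"
          then obtain s where s: "s \<in> carrier R" "x = z \<otimes> s" by blast
          then have "z \<otimes> x = x" using z by (simp flip: m_assoc)
          then show False using zx z by simp
        qed
        moreover have "x \<in> (\<otimes>) x ` carrier R" using x by (metis image_eqI)
        ultimately show "(\<otimes>) z ` carrier R \<noteq> (\<otimes>) x ` carrier R" by blast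
      qed
      then have "card ((\<otimes>) z ` carrier R) < card ((\<otimes>) x ` carrier R)"
        using fin by (intro psubset_card_mono) auto
      then obtain a where a: "a \<in> carrier R" "a \<noteq> \<zero>" "z \<otimes> a = a" "\<forall>y \<in> carrier R. y \<otimes> a \<in> {\<zero>, a}"
        using less.hyps[OF _ z(1,3)] by blast
      have "x \<otimes> a = (z \<otimes> x) \<otimes> a" using a(1,3) x(1) z(1) by (metis m_assoc m_comm)
      then have "x \<otimes> a = a" unfolding zx using a(3) by simp
      then show ?thesis using a by blast
    qed
  qed
  then show thesis using that by blast
qed

text \<open>The atoms of the Boolean ring serve as coordinate idempotents: any element multiplies an
  atom to 0 or to itself, so the scalars 0 and 1 suffice, and a nonzero element fixes some atom, so
  no nonzero element annihilates all of them.\<close>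

lemma (in cring) finite_boolean_iso_power:
  assumes K: "subfield K R" "K = {\<zero>, \<one>}" and fin: "finite (carrier R)"
    and idem: "\<And>x. x \<in> carrier R \<Longrightarrow> x \<otimes> x = x"
  shows "\<exists>n>0. R \<simeq> RDirProd_list (replicate n (R\<lparr>carrier := K\<rparr>))"
proof -
  define A where "A = {a \<in> carrier R. a \<noteq> \<zero> \<and> (\<forall>y \<in> carrier R. y \<otimes> a \<in> {\<zero>, a})}"
  have "finite A" unfolding A_def using fin by simp
  then obtain es where es: "set es = A" "distinct es" using finite_distinct_list by blast
  have atom: "\<exists>a \<in> A. x \<otimes> a = a" if x: "x \<in> carrier R" "x \<noteq> \<zero>" for x
  proof -
    obtain a where "a \<in> carrier R" "a \<noteq> \<zero>" "x \<otimes> a = a" "\<And>y. y \<in> carrier R \<Longrightarrow> y \<otimes> a \<in> {\<zero>, a}"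
      using boolean_atom_below[OF fin idem x] by blast
    then show ?thesis unfolding A_def by blast
  qed
  have "R \<simeq> RDirProd_list (replicate (length es) (R\<lparr>carrier := K\<rparr>))"
  proof (rule iso_power_of_orthogonal_idempotents[OF K(1) es(2)])
    fix e assume "e \<in> set es"
    then have e: "e \<in> A" using es by simp
    then show "e \<in> carrier R \<and> e \<noteq> \<zero> \<and> e \<otimes> e = e" unfolding A_def using idem by blast
    show "\<exists>k \<in> K. x \<otimes> e = k \<otimes> e" if "x \<in> carrier R" for x
      using that e unfolding A_def K(2) by auto
    fix f assume "f \<in> set es" "e \<noteq> f"
    then have f: "f \<in> A" using es by simp
    have eR: "e \<in> carrier R" and fR: "f \<in> carrier R" using e f unfolding A_def by auto
    \<comment> \<open>A nonzero product of two atoms would equal both of them.\<close>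
    have "e \<otimes> f \<in> {\<zero>, f}" using f eR unfolding A_def by blast
    moreover have "f \<otimes> e \<in> {\<zero>, e}" using e fR unfolding A_def by blast
    ultimately show "e \<otimes> f = \<zero>" using m_comm[OF eR fR] \<open>e \<noteq> f\<close> by auto
  next
    fix x assume x: "x \<in> carrier R" and 0: "\<And>e. e \<in> set es \<Longrightarrow> x \<otimes> e = \<zero>"
    show "x = \<zero>"
    proof (rule ccontr)
      assume "x \<noteq> \<zero>"
      then obtain a where "a \<in> A" "x \<otimes> a = a" using atom x by blast
      then show False using 0 es(1) unfolding A_def by simp
    qed
  qed
  \<comment> \<open>An atom below \<open>\<one>\<close> makes the exponent positive.\<close>
  moreover have "A \<noteq> {}" using atom[of \<one>] subfieldE(6)[OF K(1)] by auto
  then have "length es > 0" using es by auto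
  ultimately show ?thesis by blast
qed

section \<open>Finite carriers and the field with two elements\<close>

lemma finite_carrier_ZFact:
  assumes "0 < k"
  shows "finite (carrier (ZFact k))"
proof (rule finite_subset)
  show "carrier (ZFact k) \<subseteq> ZMod k ` {0..<k}"
  proof
    fix A assume "A \<in> carrier (ZFact k)"
    then obtain a where "A = ZMod k a"
      unfolding ZFact_defs A_RCOSETS_def' ZMod_def by auto
    then show "A \<in> ZMod k ` {0..<k}" using ZMod_mod[of k a] assms by auto
  qed
qed simp

lemma finite_carrier_RDirProd_list_replicate:
  assumes "finite (carrier R)"
  shows "finite (carrier (RDirProd_list (replicate n R)))"
proof (rule finite_subset)
  show "carrier (RDirProd_list (replicate n R)) \<subseteq> {xs. set xs \<subseteq> carrier R \<and> length xs = n}"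
    using RDirProd_list_carrier_mem[of _ "replicate n R"] by (fastforce simp: in_set_conv_nth)
qed (simp add: finite_lists_length_eq assms)

lemma finite_carrier_iso:
  assumes "R \<simeq> S" "finite (carrier S)"
  shows "finite (carrier R)"
  using assms bij_betw_finite unfolding is_ring_iso_def ring_iso_def by blast

text \<open>Parity defines a ring homomorphism from the integers because \<open>1 + 1 = 0\<close>.
  Its kernel is generated by 2, and the first isomorphism theorem applies.\<close>

lemma (in ring) two_element_ring_iso_ZFact:
  assumes "carrier R = {\<zero>, \<one>}" "\<one> \<noteq> \<zero>"
  shows "R \<simeq> ZFact 2"
proof -
  define h :: "int \<Rightarrow> 'a" where "h n = (if even n then \<zero> else \<one>)" for n
  \<comment> \<open>The only other possible value, \<open>\<one>\<close>, would give
    \<open>\<one> = \<zero>\<close> by cancellation.\<close>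
  have 2: "\<one> \<oplus> \<one> = \<zero>"
  proof (rule ccontr)
    assume "\<one> \<oplus> \<one> \<noteq> \<zero>"
    then have "\<one> \<oplus> \<one> = \<one>" using assms(1) add.m_closed[OF one_closed one_closed] by blast
    then show False using assms(2) by (metis add.r_cancel_one one_closed)
  qed
  interpret h: ring_hom_ring \<Z> R h
    by (rule ring_hom_ringI2[OF int.ring_axioms ring_axioms], rule ring_hom_memI)
      (auto simp: h_def 2)
  have "h ` carrier \<Z> = carrier R"
  proof -
    have "h 0 = \<zero>" "h 1 = \<one>" unfolding h_def by auto
    then show ?thesis using assms(1) h.hom_closed by (auto, metis rangeI, metis rangeI)
  qed
  then have "\<Z> Quot (a_kernel \<Z> R h) \<simeq> R" by (rule ring_hom_ring.FactRing_iso[OF h.ring_hom_ring_axioms])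
  moreover have "a_kernel \<Z> R h = Idl\<^bsub>\<Z>\<^esub> {2}"
    using assms(2) unfolding a_kernel_def' int_Idl h_def by (auto elim!: evenE)
  ultimately have "ZFact 2 \<simeq> R" unfolding ZFact_def by simp
  then show ?thesis
    using ring_iso_sym cring.axioms(1)[OF ZFact_is_cring] by blast
qed

section \<open>Strong locality, inertness and algebraic closedness\<close>

text \<open>The units of \<open>K\<close> are its nonzero elements, which are units of
  \<open>S\<close>, while 0 is not; so equality of the unit groups comes down to one
  inclusion.\<close>

lemma strongly_local_subfield_iff:
  assumes "cring S" "subfield K S"
  shows "strongly_local K S \<longleftrightarrow> Units S \<subseteq> K"
proof -
  interpret cring S by fact
  have "K - {\<zero>\<^bsub>S\<^esub>} \<subseteq> Units S"
    using subfield_m_inv[OF assms(2)] subfieldE(3)[OF assms(2)]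
    by (blast intro: Units_right_inverseI)
  moreover have "\<zero>\<^bsub>S\<^esub> \<notin> Units S"
    using subfieldE(6)[OF assms(2)] unfolding Units_def by auto
  ultimately show ?thesis
    unfolding strongly_local_def subfield.subfield_Units[OF assms(2)] by blast
qed

text \<open>A unit and its inverse multiply to \<open>\<one>\<close>, a nonzero element of
  \<open>K\<close>. Conversely, a factor of a nonzero scalar is a unit.\<close>

lemma (in cring) weakly_strongly_inert_iff_Units:
  assumes K: "subfield K R"
  shows "weakly_strongly_inert K R \<longleftrightarrow> Units R \<subseteq> K"
proof
  assume wsi: "weakly_strongly_inert K R"
  show "Units R \<subseteq> K"
  proof
    fix u assume u: "u \<in> Units R"
    have inv: "u \<otimes> inv u = \<one>" "u \<in> carrier R" "inv u \<in> carrier R" using u by auto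
    have one: "\<one> \<in> K - {\<zero>}"
      using subringE(3)[OF subfieldE(1)[OF K]] subfieldE(6)[OF K] by simp
    have "u \<in> carrier R - {\<zero>}" "inv u \<in> carrier R - {\<zero>}" using inv one by auto
    moreover have "u \<otimes> inv u \<in> K - {\<zero>}" unfolding inv(1) by (rule one)
    ultimately show "u \<in> K" using wsi unfolding weakly_strongly_inert_def by blast
  qed
next
  assume U: "Units R \<subseteq> K"
  have left: "a \<in> K" if a: "a \<in> carrier R" and b: "b \<in> carrier R" and ab: "a \<otimes> b \<in> K - {\<zero>}" for a b
  proof -
    have i: "inv (a \<otimes> b) \<in> carrier R"
      using subfield_m_inv(1)[OF K ab] subfieldE(3)[OF K] by auto
    have "a \<otimes> (b \<otimes> inv (a \<otimes> b)) = \<one>"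
      using subfield_m_inv(2)[OF K ab] a b i by (simp add: m_assoc)
    then have "a \<in> Units R" using a b i by (intro Units_right_inverseI) auto
    then show ?thesis using U by blast
  qed
  show "weakly_strongly_inert K R"
    unfolding weakly_strongly_inert_def
  proof (intro ballI impI)
    fix a b assume "a \<in> carrier R - {\<zero>}" "b \<in> carrier R - {\<zero>}" "a \<otimes> b \<in> K - {\<zero>}"
    then show "a \<in> K \<and> b \<in> K" using left[of a b] left[of b a] m_comm[of a b] by auto
  qed
qed

text \<open>In a domain a product of nonzero elements is nonzero, so the two premises agree.\<close>

lemma (in domain) strongly_inert_iff_weakly_strongly_inert:
  "strongly_inert K R \<longleftrightarrow> weakly_strongly_inert K R"
  unfolding strongly_inert_def weakly_strongly_inert_def
  using integral_iff by auto

text \<open>If a nonzero \<open>x\<close> is algebraic, then \<open>K[x]\<close> is a field, so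
  \<open>x\<close> is a unit of \<open>R\<close> and lies in \<open>K\<close>.\<close>

lemma (in domain) algebraically_closed_in_if_Units_subset:
  assumes K: "subfield K R" and U: "Units R \<subseteq> K"
  shows "algebraically_closed_in K R"
  unfolding algebraically_closed_in_def
proof (intro ballI impI)
  fix x assume x: "x \<in> carrier R" and alg: "(algebraic over K) x"
  show "x \<in> K"
  proof (cases "x = \<zero>")
    case True
    then show ?thesis using subringE(2)[OF subfieldE(1)[OF K]] by simp
  next
    case False
    let ?L = "simple_extension K x"
    have L: "subfield ?L R" using simple_extension_is_subfield[OF K x] alg by blast
    have "x \<in> ?L - {\<zero>}" using simple_extension_mem[OF subfieldE(1)[OF K] x] False by simp
    then have "x \<otimes> inv x = \<one>" "inv x \<in> carrier R"
      using subfield_m_inv[OF L] subfieldE(3)[OF L] by auto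
    then show ?thesis using U x Units_right_inverseI by blast
  qed
qed

section \<open>The FCP criterion and the conclusion\<close>

lemma FCP_refl: "FCP (carrier S) S"
  unfolding FCP_def
proof (intro allI impI)
  fix \<C> assume "subset.chain (intermediate_rings (carrier S) S) \<C>"
  moreover have "intermediate_rings (carrier S) S \<subseteq> {carrier S}"
    unfolding intermediate_rings_def using subringE(1) by blast
  ultimately show "finite \<C>" unfolding subset_chain_def by (blast intro: finite_subset[of _ "{carrier S}"])
qed

lemma FCP_if_finite_carrier:
  assumes "finite (carrier S)"
  shows "FCP K S"
  unfolding FCP_def
proof (intro allI impI)
  fix \<C> assume "subset.chain (intermediate_rings K S) \<C>"
  then have "\<C> \<subseteq> intermediate_rings K S" unfolding subset_chain_def by blast
  also have "\<dots> \<subseteq> Pow (carrier S)"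
    unfolding intermediate_rings_def using subringE(1)[of _ S] by blast
  finally show "finite \<C>" by (rule finite_subset) (simp add: assms)
qed

lemma (in cring) FCP_strongly_local_iff:
  assumes K: "subfield K R" and U: "Units R \<subseteq> K"
  shows "FCP K R \<longleftrightarrow> K = carrier R \<or>
    (R\<lparr>carrier := K\<rparr> \<simeq> ZFact 2 \<and>
      (\<exists>n>0. R \<simeq> RDirProd_list (replicate n (R\<lparr>carrier := K\<rparr>))))"
    (is "_ \<longleftrightarrow> _ \<or> ?power")
proof
  assume FCP: "FCP K R"
  show "K = carrier R \<or> ?power"
  proof (cases "K = carrier R")
    case False
    note bool = strongly_local_FCP_boolean[OF K U FCP False]
    have idem: "x \<otimes> x = x" if "x \<in> carrier R" for x using bool(2) that by blast
    have "finite K" using bool(1) by simp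
    then have "finite (carrier R)"
      using FCP_boolean_finite[OF subfieldE(1)[OF K] _ FCP] idem by blast
    then have "\<exists>n>0. R \<simeq> RDirProd_list (replicate n (R\<lparr>carrier := K\<rparr>))"
      using finite_boolean_iso_power[OF K bool(1)] idem by blast
    moreover have "R\<lparr>carrier := K\<rparr> \<simeq> ZFact 2"
      using ring.two_element_ring_iso_ZFact[OF subring_is_ring[OF subfieldE(1)[OF K]]]
        bool(1) subfieldE(6)[OF K] by simp
    ultimately show ?thesis by blast
  qed simp
next
  assume "K = carrier R \<or> ?power"
  then show "FCP K R"
  proof
    assume "K = carrier R"
    then show ?thesis using FCP_refl[of R] by simp
  next
    assume power: ?power
    \<comment> \<open>The two isomorphisms transport finiteness: from \<open>ZFact 2\<close> to
      \<open>K\<close>, and from the power of \<open>K\<close> to \<open>R\<close>.\<close>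
    have "finite (carrier (ZFact 2))" by (rule finite_carrier_ZFact) simp
    then have "finite (carrier (R\<lparr>carrier := K\<rparr>))" using power finite_carrier_iso by blast
    then have "finite (carrier R)"
      using power finite_carrier_iso finite_carrier_RDirProd_list_replicate by blast
    then show ?thesis by (rule FCP_if_finite_carrier)
  qed
qed

theorem corollary9p9:
  fixes S :: "('a, 'b) ring_scheme" and K :: "'a set"
  assumes "cring S" and "subfield K S"
  shows "(weakly_strongly_inert K S \<longleftrightarrow> strongly_local K S) \<and>
         (domain S \<longrightarrow>
            (strongly_inert K S \<longleftrightarrow> strongly_local K S) \<and>
            (strongly_local K S \<longrightarrow> algebraically_closed_in K S)) \<and>
         (strongly_local K S \<longrightarrow>
            (FCP K S \<longleftrightarrow>
               K = carrier S \<or>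
               (S\<lparr>carrier := K\<rparr> \<simeq> ZFact 2 \<and>
                (\<exists>n::nat. n > 0 \<and> S \<simeq> RDirProd_list (replicate n (S\<lparr>carrier := K\<rparr>))))))"
proof -
  interpret cring S by fact
  have sl: "strongly_local K S \<longleftrightarrow> Units S \<subseteq> K"
    by (rule strongly_local_subfield_iff[OF assms])
  have wsi: "weakly_strongly_inert K S \<longleftrightarrow> strongly_local K S"
    unfolding sl by (rule weakly_strongly_inert_iff_Units[OF assms(2)])
  moreover have "(strongly_inert K S \<longleftrightarrow> strongly_local K S) \<and>
      (strongly_local K S \<longrightarrow> algebraically_closed_in K S)" if "domain S"
    using wsi sl domain.strongly_inert_iff_weakly_strongly_inert[OF that, of K]
      domain.algebraically_closed_in_if_Units_subset[OF that assms(2)] by simp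
  moreover note FCP_strongly_local_iff[OF assms(2)]
  ultimately show ?thesis unfolding sl by simp
qed

end
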